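(* Let $n>\max(m_x,m_y)$ and let $X\in\mathbb{R}^{n\times m_x}$, $Y\in\mathbb{R}^{n\times m_y}$ be centered data matrices. Let $X=U_x\Sigma_xV_x^{\top}$ and $Y=U_y\Sigma_yV_y^{\top}$ be thin singular value decompositions, with $U_x\in\mathbb{R}^{n\times m_x}$, $\Sigma_x,V_x\in\mathbb{R}^{m_x\times m_x}$, $U_y\in\mathbb{R}^{n\times m_y}$, $\Sigma_y,V_y\in\mathbb{R}^{m_y\times m_y}$, and singular values $\sigma_{x,1}\ge\dots\ge\sigma_{x,m_x}$ and $\sigma_{y,1}\ge\dots\ge\sigma_{y,m_y}$ on the diagonals of $\Sigma_x$ and $\Sigma_y$. 1. (Tikhonov regularization.) Let $\gamma_x,\gamma_y>0$ and $k=\min(m_x,m_y)$. Define $$T_{\gamma_x,\gamma_y}=(\Sigma_x^2+\gamma_xI)^{-\frac12}\,\Sigma_x\,(U_x^{\top}U_y)\,\Sigma_y\,(\Sigma_y^2+\gamma_yI)^{-\frac12}\in\mathbb{R}^{m_x\times m_y},$$ and let $T_{\gamma_x,\gamma_y}=P_x\Sigma P_y^{\top}$ be its (thin) singular value decomposition, $P_x\in\mathbb{R}^{m_x\times k}$, $\Sigma\in\mathbb{R}^{k\times k}$, $P_y\in\mathbb{R}^{m_y\times k}$. Then the canonical weights of the Tikhonov regularized CCA problem with parameters $\gamma_x,\gamma_y$ are given by $$U=V_x(\Sigma_x^2+\gamma_xI)^{-\frac12}P_x,\qquad V=V_y(\Sigma_y^2+\gamma_yI)^{-\frac12}P_y,$$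 and the canonical correlations are given by $\Sigma$. 2. (Truncated SVD regularization.) Let $1\le k_x\le m_x$ and $1\le k_y\le m_y$ with $\sigma_{x,k_x}>0$ and $\sigma_{y,k_y}>0$, and let $k=\min(k_x,k_y)$. Let $U_{k_x},V_{k_x}$ be the first $k_x$ columns of $U_x,V_x$, let $\Sigma_{k_x}$ be the leading $k_x\times k_x$ block of $\Sigma_x$, and define $U_{k_y},V_{k_y},\Sigma_{k_y}$ analogously from the SVD of $Y$. Define $T_{k_x,k_y}=U_{k_x}^{\top}U_{k_y}\in\mathbb{R}^{k_x\times k_y}$ and let $T_{k_x,k_y}=P_x\Sigma P_y^{\top}$ be its (thin) singular value decomposition, $P_x\in\mathbb{R}^{k_x\times k}$, $\Sigma\in\mathbb{R}^{k\times k}$, $P_y\in\mathbb{R}^{k_y\times k}$. Then the canonical weights of the truncated SVD regularized CCA problem with parameters $k_x,k_y$ are given by $$U=V_{k_x}\Sigma_{k_x}^{-1}P_x,\qquad V=V_{k_y}\Sigma_{k_y}^{-1}P_y,$$ and the canonical correlations are given by $\Sigma$. 3. (Spectral filtering.) (Tikhonov) Let $f_{\gamma_x}(\Sigma_x)$ be the diagonal matrix with entries $\frac{\sigma_{x,j}}{\sqrt{\sigma_{x,j}^2+\gamma_x}}$, $j=1,\dots,m_x$, and define $f_{\gamma_y}(\Sigma_y)$ analogously. Then $$T_{\gamma_x,\gamma_y}=f_{\gamma_x}(\Sigma_x)\,U_x^{\top}U_y\,f_{\gamma_y}(\Sigma_y).$$ (T-SVD) Let $f_{k_x}(\Sigma_x)$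 be the diagonal matrix whose $j$-th diagonal entry is $0$ if $\sigma_{x,j}<\sigma_{x,k_x}$ and $1$ if $\sigma_{x,j}\ge\sigma_{x,k_x}$, and define $f_{k_y}(\Sigma_y)$ analogously. Let $T_f^{k_x,k_y}=f_{k_x}(\Sigma_x)\,U_x^{\top}U_y\,f_{k_y}(\Sigma_y)$. Then $$T_{k_x,k_y}=T_f^{k_x,k_y}(1:k_x,\,1:k_y),$$ where $A(1:k_x,1:k_y)$ denotes the submatrix of $A$ consisting of its first $k_x$ rows and first $k_y$ columns.
   Context: Singular value decompositions (SVD) are thin: for $A\in\mathbb{R}^{p\times q}$ and $r=\min(p,q)$, $A=P\Sigma Q^{\top}$ with $P\in\mathbb{R}^{p\times r}$ and $Q\in\mathbb{R}^{q\times r}$ having orthonormal columns and $\Sigma\in\mathbb{R}^{r\times r}$ diagonal with nonnegative entries in decreasing order. A data matrix is centered if the mean of its rows is zero. Tikhonov regularized CCA (canonical correlation analysis) with parameters $\gamma_x,\gamma_y>0$, with $k=\min(m_x,m_y)$, is the problem, over $U\in\mathbb{R}^{m_x\times k}$ and $V\in\mathbb{R}^{m_y\times k}$, $$\max\ \mathrm{Tr}(U^{\top}X^{\top}YV)\quad\text{subject to } U^{\top}(X^{\top}X+\gamma_xI_{m_x})U=I_k,\quad V^{\top}(Y^{\top}Y+\gamma_yI_{m_y})V=I_k.$$ Truncated SVD (T-SVD) regularized CCA with parameters $k_x,k_y$, with $k=\min(k_x,k_y)$: let $X_{k_x}=U_{k_x}\Sigma_{k_x}V_{k_x}^{\top}$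 and $Y_{k_y}=U_{k_y}\Sigma_{k_y}V_{k_y}^{\top}$ be the best rank-$k_x$ and rank-$k_y$ approximations of $X$ and $Y$ given by truncating their SVDs. The problem is, over $U\in\mathbb{R}^{m_x\times k}$ and $V\in\mathbb{R}^{m_y\times k}$, $$\max\ \mathrm{Tr}(U^{\top}X^{\top}YV)\quad\text{subject to } U^{\top}X_{k_x}^{\top}X_{k_x}U=I_k,\quad V^{\top}Y_{k_y}^{\top}Y_{k_y}V=I_k.$$ For either problem, the canonical weights are the columns of a solution $(U,V)$ of the maximization problem, and the canonical correlations are $\sigma_i=u_i^{\top}X^{\top}Yv_i$, $i=1,\dots,k$, where $u_i,v_i$ are the $i$-th columns of $U$ and $V$; they are collected in the diagonal matrix $\Sigma=\mathrm{diag}(\sigma_1,\dots,\sigma_k)$.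
   Formalization: Part 2: the T-SVD problem as stated can be unbounded when rank X > k_x or rank Y > k_y; (U,V) is shown to solve it whenever a solution exists, and always with weights restricted to the row spaces of X_{k_x}, Y_{k_y}, or with X_{k_x}, Y_{k_y} in the objective. *)

theory Defs
  imports "Jordan_Normal_Form.Gauss_Jordan_Elimination" Complex_Main
begin

definition centered :: "real mat \<Rightarrow> bool" where
  "centered A \<longleftrightarrow> (\<forall>j < dim_col A. (\<Sum>i < dim_row A. A $$ (i, j)) / real (dim_row A) = 0)"

definition mtrace :: "real mat \<Rightarrow> real" where
  "mtrace A = (\<Sum>i < dim_row A. A $$ (i, i))"

definition thin_svd :: "real mat \<Rightarrow> real mat \<Rightarrow> real mat \<Rightarrow> real mat \<Rightarrow> bool" where
  "thin_svd A P S Q \<longleftrightarrow>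
     (let r = min (dim_row A) (dim_col A) in
       P \<in> carrier_mat (dim_row A) r \<and> S \<in> carrier_mat r r \<and> Q \<in> carrier_mat (dim_col A) r \<and>
       transpose_mat P * P = 1\<^sub>m r \<and> transpose_mat Q * Q = 1\<^sub>m r \<and>
       diagonal_mat S \<and>
       (\<forall>i < r. 0 \<le> S $$ (i, i)) \<and>
       (\<forall>i < r. \<forall>j < r. i \<le> j \<longrightarrow> S $$ (j, j) \<le> S $$ (i, i)) \<and>
       A = P * S * transpose_mat Q)"

(* Only meaningful for r \<le> dim_row A and c \<le> dim_col A. *)
definition leading_block :: "nat \<Rightarrow> nat \<Rightarrow> real mat \<Rightarrow> real mat" where
  "leading_block r c A = mat r c (\<lambda>(i, j). A $$ (i, j))"

definition truncated_svd :: "nat \<Rightarrow> real mat \<Rightarrow> real mat \<Rightarrow> real mat \<Rightarrow> real mat" where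
  "truncated_svd k P S Q =
     leading_block (dim_row P) k P * leading_block k k S
       * transpose_mat (leading_block (dim_row Q) k Q)"

definition pos_def_mat :: "real mat \<Rightarrow> bool" where
  "pos_def_mat B \<longleftrightarrow>
     square_mat B \<and> transpose_mat B = B \<and>
     (\<forall>v \<in> carrier_vec (dim_row B). v \<noteq> 0\<^sub>v (dim_row B) \<longrightarrow> 0 < v \<bullet> (B *\<^sub>v v))"

(* For positive definite A this is A to the power -1/2: the unique positive definite
   square root of the inverse of A. *)
definition inv_sqrt_mat :: "real mat \<Rightarrow> real mat" where
  "inv_sqrt_mat A =
     (THE B. B \<in> carrier_mat (dim_row A) (dim_row A) \<and> pos_def_mat B \<and> inverts_mat A (B * B))"

(* The inverse; unspecified on singular matrices. *)
definition inv_mat :: "real mat \<Rightarrow> real mat" where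
  "inv_mat A = the (mat_inverse A)"


definition cca_objective :: "real mat \<Rightarrow> real mat \<Rightarrow> real mat \<times> real mat \<Rightarrow> real" where
  "cca_objective X Y = (\<lambda>(U, V). mtrace (transpose_mat U * transpose_mat X * Y * V))"

(* Normalization of k weight vectors per data set with respect to the symmetric matrices A, B. *)
definition cca_feasible ::
    "nat \<Rightarrow> real mat \<Rightarrow> real mat \<Rightarrow> real mat \<times> real mat \<Rightarrow> bool" where
  "cca_feasible k A B = (\<lambda>(U, V).
     U \<in> carrier_mat (dim_row A) k \<and> V \<in> carrier_mat (dim_row B) k \<and>
     transpose_mat U * A * U = 1\<^sub>m k \<and> transpose_mat V * B * V = 1\<^sub>m k)"

definition tikhonov_cca_solution ::
    "real \<Rightarrow> real \<Rightarrow> real mat \<Rightarrow> real mat \<Rightarrow> real mat \<times> real mat \<Rightarrow> bool" where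
  "tikhonov_cca_solution gx gy X Y =
     is_arg_max (cca_objective X Y)
       (cca_feasible (min (dim_col X) (dim_col Y))
         (transpose_mat X * X + gx \<cdot>\<^sub>m 1\<^sub>m (dim_col X))
         (transpose_mat Y * Y + gy \<cdot>\<^sub>m 1\<^sub>m (dim_col Y)))"

definition tsvd_cca_feasible ::
    "nat \<Rightarrow> nat \<Rightarrow> real mat \<Rightarrow> real mat \<Rightarrow> real mat \<times> real mat \<Rightarrow> bool" where
  "tsvd_cca_feasible kx ky Xk Yk =
     cca_feasible (min kx ky) (transpose_mat Xk * Xk) (transpose_mat Yk * Yk)"

(* X, Y enter the objective, their truncations Xk, Yk the constraints.  If X has rank greater
   than kx (or Y rank greater than ky), the objective can be unbounded on the feasible set,
   because components of the weights in the kernel of Xk are not constrained. *)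
definition tsvd_cca_solution ::
    "nat \<Rightarrow> nat \<Rightarrow> real mat \<Rightarrow> real mat \<Rightarrow> real mat \<Rightarrow> real mat \<Rightarrow> real mat \<times> real mat \<Rightarrow> bool" where
  "tsvd_cca_solution kx ky Xk Yk X Y =
     is_arg_max (cca_objective X Y) (tsvd_cca_feasible kx ky Xk Yk)"

definition cols_in_row_space :: "real mat \<Rightarrow> real mat \<Rightarrow> bool" where
  "cols_in_row_space A U \<longleftrightarrow>
     (\<exists>W \<in> carrier_mat (dim_row A) (dim_col U). U = transpose_mat A * W)"

(* The same problem with the weight vectors restricted to the retained subspaces, that is to
   the row spaces of the truncated matrices, which removes the unconstrained directions. *)
definition tsvd_cca_row_space_solution ::
    "nat \<Rightarrow> nat \<Rightarrow> real mat \<Rightarrow> real mat \<Rightarrow> real mat \<Rightarrow> real mat \<Rightarrow> real mat \<times> real mat \<Rightarrow> bool" where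
  "tsvd_cca_row_space_solution kx ky Xk Yk X Y =
     is_arg_max (cca_objective X Y)
       (\<lambda>(U, V). tsvd_cca_feasible kx ky Xk Yk (U, V) \<and>
          cols_in_row_space Xk U \<and> cols_in_row_space Yk V)"

definition canonical_correlations ::
    "real mat \<Rightarrow> real mat \<Rightarrow> real mat \<times> real mat \<Rightarrow> real mat" where
  "canonical_correlations X Y = (\<lambda>(U, V).
     mat_diag (dim_col U) (\<lambda>i. col U i \<bullet> ((transpose_mat X * Y) *\<^sub>v col V i)))"


definition tikhonov_whitener :: "real \<Rightarrow> real mat \<Rightarrow> real mat" where
  "tikhonov_whitener g S = inv_sqrt_mat (S * S + g \<cdot>\<^sub>m 1\<^sub>m (dim_row S))"

definition tikhonov_T ::
    "real \<Rightarrow> real \<Rightarrow> real mat \<Rightarrow> real mat \<Rightarrow> real mat \<Rightarrow> real mat \<Rightarrow> real mat" where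
  "tikhonov_T gx gy Ux Sx Uy Sy =
     tikhonov_whitener gx Sx * Sx * (transpose_mat Ux * Uy) * Sy * tikhonov_whitener gy Sy"

definition tsvd_T :: "nat \<Rightarrow> nat \<Rightarrow> real mat \<Rightarrow> real mat \<Rightarrow> real mat" where
  "tsvd_T kx ky Ux Uy =
     transpose_mat (leading_block (dim_row Ux) kx Ux) * leading_block (dim_row Uy) ky Uy"

definition tikhonov_filter :: "real \<Rightarrow> real mat \<Rightarrow> real mat" where
  "tikhonov_filter g S =
     mat_diag (dim_row S) (\<lambda>j. S $$ (j, j) / sqrt ((S $$ (j, j))\<^sup>2 + g))"

(* Indices start at 0, so the k-th singular value is the entry at (k - 1, k - 1). *)
definition tsvd_filter :: "nat \<Rightarrow> real mat \<Rightarrow> real mat" where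
  "tsvd_filter k S =
     mat_diag (dim_row S) (\<lambda>j. if S $$ (j, j) < S $$ (k - 1, k - 1) then 0 else 1)"

end

theory Submission
  imports Defs "Jordan_Normal_Form.Determinant"
begin

text \<open>Write the constraint matrices as \<open>G\<^sub>x\<^sup>T G\<^sub>x\<close> and \<open>G\<^sub>y\<^sup>T G\<^sub>y\<close>, with
  \<open>G\<^sub>x = (\<Sigma>\<^sub>x\<^sup>2 + \<gamma>\<^sub>x I)\<^bsup>1/2\<^esup> V\<^sub>x\<^sup>T\<close> for Tikhonov and \<open>G\<^sub>x = \<Sigma>\<^sub>k\<^sub>x V\<^sub>k\<^sub>x\<^sup>T\<close> for truncation. Then
  \<open>X\<^sup>T Y = G\<^sub>x\<^sup>T T G\<^sub>y\<close>, so substituting \<open>p = G\<^sub>x U\<close>, \<open>q = G\<^sub>y V\<close> turns either problem into the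
  maximization of the trace of \<open>p\<^sup>T T q\<close> over matrices with orthonormal columns, which von
  Neumann's trace inequality solves. For truncation the identity holds for the truncated data,
  and \<open>X\<close> agrees with its truncation on the retained row space. If the unrestricted problem
  has any solution, projecting it to the row spaces does not decrease the objective.\<close>

section \<open>Products, transposes and traces of matrices; diagonal matrices\<close>

text \<open>The side conditions compare dimensions instead of naming carriers, so no variable occurs
  in the premises alone and rewriting can discharge them.\<close>

lemma mult_mat_assoc:
  fixes A :: "'a :: semiring_0 mat"
  assumes "dim_col A = dim_row B" and "dim_col B = dim_row C"
  shows "A * B * C = A * (B * C)"
  using assms by (intro assoc_mult_mat) auto

text \<open>In a product associated to the right, a pair with known value \<open>A * B\<close> never
  stands as a subterm; this form lets the known value be used there.\<close>

lemma mult_mat_assoc_eq: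
  fixes A :: "'a :: semiring_0 mat"
  assumes "A * B = D" and "dim_col A = dim_row B" and "dim_col B = dim_row C"
  shows "A * (B * C) = D * C"
  using mult_mat_assoc[of A B C] assms by simp

lemma transpose_mult_dim:
  fixes A :: "'a :: comm_semiring_0 mat"
  assumes "dim_col A = dim_row B"
  shows "transpose_mat (A * B) = transpose_mat B * transpose_mat A"
  using assms by (intro transpose_mult) auto

lemmas mat_mult_normalize = mult_mat_assoc transpose_mult_dim

lemma mult_mat_index:
  fixes A :: "'a :: semiring_0 mat"
  assumes "dim_col A = dim_row B" and "i < dim_row A" and "j < dim_col B"
  shows "(A * B) $$ (i, j) = (\<Sum>l < dim_row B. A $$ (i, l) * B $$ (l, j))"
  using assms by (auto simp: scalar_prod_def atLeast0LessThan intro!: sum.cong)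

lemma diagonal_mat_eq_mat_diag:
  assumes "A \<in> carrier_mat n n" and "diagonal_mat A"
  shows "A = mat_diag n (\<lambda>i. A $$ (i, i))"
  using assms by (intro eq_matI) (auto simp: mat_diag_def diagonal_mat_def)

lemma transpose_mat_diag [simp]: "transpose_mat (mat_diag n f) = mat_diag n f"
  by (intro eq_matI) (auto simp: mat_diag_def)

lemma dim_mat_diag [simp]: "dim_row (mat_diag n f) = n" "dim_col (mat_diag n f) = n"
  by (auto simp: mat_diag_def)

lemma mtrace_mult_commute:
  assumes "A \<in> carrier_mat n m" and "B \<in> carrier_mat m n"
  shows "mtrace (A * B) = mtrace (B * A)"
proof -
  have "mtrace (A * B) = (\<Sum>i<n. \<Sum>l<m. A $$ (i, l) * B $$ (l, i))"
    using assms by (auto simp: mtrace_def mult_mat_index simp del: index_mult_mat(1))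
  also have "\<dots> = (\<Sum>l<m. \<Sum>i<n. B $$ (l, i) * A $$ (i, l))"
    by (subst sum.swap) (simp add: mult.commute)
  also have "\<dots> = mtrace (B * A)"
    using assms by (auto simp: mtrace_def mult_mat_index simp del: index_mult_mat(1))
  finally show ?thesis .
qed

section \<open>Bessel's inequality and von Neumann's trace inequality\<close>

lemma gram_diag_nonneg:
  fixes R :: "real mat"
  assumes "i < dim_col R"
  shows "0 \<le> (transpose_mat R * R) $$ (i, i)"
  using assms by (subst mult_mat_index) (auto intro!: sum_nonneg)

text \<open>Bessel's inequality: \<open>1 - Z Z\<^sup>T\<close> is the Gram matrix of \<open>P - p p\<^sup>T P\<close>.\<close>

lemma orthonormal_cols_row_norm_le:
  fixes P p :: "real mat"
  assumes P: "P \<in> carrier_mat a r" "transpose_mat P * P = 1\<^sub>m r"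
    and p: "p \<in> carrier_mat a k" "transpose_mat p * p = 1\<^sub>m k"
    and i: "i < r"
  shows "(\<Sum>j<k. ((transpose_mat P * p) $$ (i, j))\<^sup>2) \<le> 1"
proof -
  define Z where "Z = transpose_mat P * p"
  define R where "R = P - p * transpose_mat Z"
  have dims [simp]: "dim_row P = a" "dim_col P = r" "dim_row p = a" "dim_col p = k"
    "dim_row Z = r" "dim_col Z = k" "dim_row R = a" "dim_col R = r"
    using P p by (auto simp: Z_def R_def)
  have PZ: "transpose_mat P * p = Z" and pP: "transpose_mat p * P = transpose_mat Z"
    by (simp_all add: Z_def transpose_mult_dim)
  have c: "P \<in> carrier_mat a r" "p \<in> carrier_mat a k"
    "transpose_mat P \<in> carrier_mat r a" "transpose_mat p \<in> carrier_mat k a"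
    by (rule carrier_matI; simp)+
  have Z: "Z \<in> carrier_mat r k" and Z': "transpose_mat Z \<in> carrier_mat k r"
    and R: "R \<in> carrier_mat a r" and ZZ: "Z * transpose_mat Z \<in> carrier_mat r r"
    by (rule carrier_matI; simp)+
  have Rt: "transpose_mat R = transpose_mat P - Z * transpose_mat p"
    unfolding R_def
    by (subst transpose_minus[OF c(1)]) (auto simp: transpose_mult_dim intro: carrier_matI)
  have "transpose_mat p * R = transpose_mat p * P - transpose_mat p * (p * transpose_mat Z)"
    unfolding R_def by (rule mult_minus_distrib_mat[OF c(4) c(1)]) (rule carrier_matI; simp)
  also have "\<dots> = transpose_mat Z - transpose_mat Z"
    by (simp add: pP mult_mat_assoc_eq[OF p(2)])
  also have "\<dots> = 0\<^sub>m k r"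
    by (rule minus_r_inv_mat[OF Z'])
  finally have pR: "transpose_mat p * R = 0\<^sub>m k r" .
  have PR: "transpose_mat P * R = 1\<^sub>m r - Z * transpose_mat Z"
  proof -
    have "transpose_mat P * R = transpose_mat P * P - transpose_mat P * (p * transpose_mat Z)"
      unfolding R_def by (rule mult_minus_distrib_mat[OF c(3) c(1)]) (rule carrier_matI; simp)
    then show ?thesis
      by (simp add: P(2) mult_mat_assoc_eq[OF PZ])
  qed
  have "transpose_mat R * R = transpose_mat P * R - Z * transpose_mat p * R"
    unfolding Rt by (rule minus_mult_distrib_mat[OF c(3) _ R]) (rule carrier_matI; simp)
  also have "Z * transpose_mat p * R = 0\<^sub>m r r"
    using right_mult_zero_mat[OF Z] by (simp add: mult_mat_assoc pR)
  finally have "transpose_mat R * R = 1\<^sub>m r - Z * transpose_mat Z"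
    unfolding PR using ZZ by (intro eq_matI) auto
  \<comment> \<open>The diagonal entry of \<open>Z * transpose_mat Z\<close> is the squared norm of
    row \<open>i\<close> of \<open>Z\<close>.\<close>
  then have "0 \<le> 1 - (Z * transpose_mat Z) $$ (i, i)"
    using gram_diag_nonneg[of i R] i by simp
  then show ?thesis
    using i by (simp add: mult_mat_index power2_eq_square flip: Z_def del: index_mult_mat(1))
qed

lemma thin_svdD:
  assumes "thin_svd A P S Q" and "A \<in> carrier_mat a b"
  shows "P \<in> carrier_mat a (min a b)" and "S \<in> carrier_mat (min a b) (min a b)"
    and "Q \<in> carrier_mat b (min a b)"
    and "transpose_mat P * P = 1\<^sub>m (min a b)" and "transpose_mat Q * Q = 1\<^sub>m (min a b)"
    and "diagonal_mat S"
    and "\<And>i. i < min a b \<Longrightarrow> 0 \<le> S $$ (i, i)"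
    and "\<And>i j. i \<le> j \<Longrightarrow> j < min a b \<Longrightarrow> S $$ (j, j) \<le> S $$ (i, i)"
    and "A = P * S * transpose_mat Q"
  using assms by (auto simp: thin_svd_def Let_def)

text \<open>A form of von Neumann's trace inequality. In the coordinates \<open>Z = P\<^sup>T p\<close>, \<open>W = Q\<^sup>T q\<close> the
  trace is the sum of \<open>s\<^sub>i Z\<^sub>i\<^sub>j W\<^sub>i\<^sub>j\<close>, and AM-GM reduces it to Bessel's inequality for each
  row.\<close>

lemma mtrace_le_mtrace_singular_values:
  fixes T :: "real mat"
  assumes svd: "thin_svd T P S Q" and T: "T \<in> carrier_mat a b"
    and p: "p \<in> carrier_mat a k" "transpose_mat p * p = 1\<^sub>m k"
    and q: "q \<in> carrier_mat b k" "transpose_mat q * q = 1\<^sub>m k"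
  shows "mtrace (transpose_mat p * T * q) \<le> mtrace S"
proof -
  define r where "r = min a b"
  note D = thin_svdD[OF svd T, folded r_def]
  define s where "s i = S $$ (i, i)" for i
  have S: "S = mat_diag r s"
    unfolding s_def by (rule diagonal_mat_eq_mat_diag[OF D(2,6)])
  define Z where "Z = transpose_mat P * p"
  define W where "W = transpose_mat Q * q"
  have dims [simp]: "dim_row P = a" "dim_col P = r" "dim_row p = a" "dim_col p = k"
    "dim_row Q = b" "dim_col Q = r" "dim_row q = b" "dim_col q = k"
    "dim_row Z = r" "dim_col Z = k" "dim_row W = r" "dim_col W = k"
    using D p q by (auto simp: Z_def W_def)
  have "transpose_mat p * T * q = transpose_mat Z * (mat_diag r s * W)"
    by (simp add: Z_def W_def D(9) S mat_mult_normalize)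
  then have "mtrace (transpose_mat p * T * q) = (\<Sum>j<k. \<Sum>i<r. Z $$ (i, j) * (s i * W $$ (i, j)))"
    by (auto simp: mtrace_def mult_mat_index mat_diag_mult_left[of W r k] carrier_matI
        simp del: index_mult_mat(1) intro!: sum.cong)
  also have "\<dots> = (\<Sum>i<r. s i * (\<Sum>j<k. Z $$ (i, j) * W $$ (i, j)))"
    by (subst sum.swap) (simp add: sum_distrib_left mult_ac)
  also have "\<dots> \<le> (\<Sum>i<r. s i)"
  proof (rule sum_mono)
    fix i assume "i \<in> {..<r}"
    then have i: "i < r" by simp
    have "(\<Sum>j<k. Z $$ (i, j) * W $$ (i, j))
        \<le> (\<Sum>j<k. ((Z $$ (i, j))\<^sup>2 + (W $$ (i, j))\<^sup>2) / 2)"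
    proof (rule sum_mono)
      fix j
      show "Z $$ (i, j) * W $$ (i, j) \<le> ((Z $$ (i, j))\<^sup>2 + (W $$ (i, j))\<^sup>2) / 2"
        using sum_squares_bound[of "Z $$ (i, j)" "W $$ (i, j)"] by simp
    qed
    also have "\<dots> = ((\<Sum>j<k. (Z $$ (i, j))\<^sup>2) + (\<Sum>j<k. (W $$ (i, j))\<^sup>2)) / 2"
      by (simp add: sum.distrib flip: sum_divide_distrib)
    also have "\<dots> \<le> 1"
      using orthonormal_cols_row_norm_le[OF D(1,4) p i, folded Z_def]
        orthonormal_cols_row_norm_le[OF D(3,5) q i, folded W_def] by simp
    finally show "s i * (\<Sum>j<k. Z $$ (i, j) * W $$ (i, j)) \<le> s i"
      using D(7)[OF i] mult_left_mono[of _ 1 "s i"] by (simp add: s_def)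
  qed
  also have "\<dots> = mtrace S"
    using D(2) by (simp add: mtrace_def s_def)
  finally show ?thesis .
qed

text \<open>Shows that the trace inequality is sharp: its bound is attained at \<open>p = P\<close>,
  \<open>q = Q\<close>.\<close>

lemma thin_svd_inner_eq:
  assumes svd: "thin_svd T P S Q" and T: "T \<in> carrier_mat a b"
  shows "transpose_mat P * (T * Q) = S"
proof -
  note D = thin_svdD[OF svd T]
  have [simp]: "dim_row P = a" "dim_col P = min a b" "dim_row Q = b" "dim_col Q = min a b"
    "dim_row S = min a b" "dim_col S = min a b"
    using D by auto
  show ?thesis
    by (subst D(9)) (simp add: mult_mat_assoc D(5) mult_mat_assoc_eq[OF D(4)])
qed

section \<open>The whitened problem and its canonical correlations\<close>

text \<open>Objective and constraints see the weights only through \<open>Gx * U\<close> and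
  \<open>Gy * V\<close>, so any weights that are mapped to the singular vectors of \<open>T\<close>
  are optimal. This covers square \<open>Gx\<close> (Tikhonov) as well as \<open>Gx\<close> with a
  kernel (truncation).\<close>

lemma whitened_cca_solution:
  assumes X: "X \<in> carrier_mat n mx" and Y: "Y \<in> carrier_mat n my"
    and Gx: "Gx \<in> carrier_mat a mx" and Gy: "Gy \<in> carrier_mat b my"
    and T: "T \<in> carrier_mat a b" and svd: "thin_svd T P S Q"
    and cross: "transpose_mat X * Y = transpose_mat Gx * T * Gy"
    and U: "U \<in> carrier_mat mx (min a b)" "Gx * U = P"
    and V: "V \<in> carrier_mat my (min a b)" "Gy * V = Q"
  shows "is_arg_max (cca_objective X Y)
      (cca_feasible (min a b) (transpose_mat Gx * Gx) (transpose_mat Gy * Gy)) (U, V)"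
    and "transpose_mat U * (transpose_mat X * Y) * V = S"
proof -
  have [simp]: "dim_row X = n" "dim_col X = mx" "dim_row Y = n" "dim_col Y = my"
    "dim_row Gx = a" "dim_col Gx = mx" "dim_row Gy = b" "dim_col Gy = my"
    "dim_row T = a" "dim_col T = b"
    using X Y Gx Gy T by auto
  note D = thin_svdD[OF svd T]
  have obj: "transpose_mat U' * (transpose_mat X * Y) * V' = transpose_mat (Gx * U') * T * (Gy * V')"
    if "dim_row U' = mx" "dim_row V' = my" for U' V'
    using that by (simp add: cross mat_mult_normalize)
  have obj': "cca_objective X Y (U', V') = mtrace (transpose_mat (Gx * U') * T * (Gy * V'))"
    if "dim_row U' = mx" "dim_row V' = my" for U' V'
    using obj[OF that] that by (simp add: cca_objective_def mult_mat_assoc)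
  have feas: "transpose_mat U' * (transpose_mat Gx * Gx) * U' = transpose_mat (Gx * U') * (Gx * U')"
    if "dim_row U' = mx" for U'
    using that by (simp add: mat_mult_normalize)
  have feas': "transpose_mat V' * (transpose_mat Gy * Gy) * V' = transpose_mat (Gy * V') * (Gy * V')"
    if "dim_row V' = my" for V'
    using that by (simp add: mat_mult_normalize)
  have [simp]: "dim_row U = mx" "dim_row V = my" using U V by auto
  have [simp]: "dim_row P = a" "dim_col P = min a b" "dim_row Q = b" "dim_col Q = min a b"
    using D by auto
  show *: "transpose_mat U * (transpose_mat X * Y) * V = S"
    by (subst obj) (simp_all add: U V mult_mat_assoc thin_svd_inner_eq[OF svd T])
  have val: "cca_objective X Y (U, V) = mtrace S"
    using * U V by (simp add: cca_objective_def mult_mat_assoc)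
  show "is_arg_max (cca_objective X Y)
      (cca_feasible (min a b) (transpose_mat Gx * Gx) (transpose_mat Gy * Gy)) (U, V)"
    unfolding is_arg_max_def
  proof (intro conjI notI)
    show "cca_feasible (min a b) (transpose_mat Gx * Gx) (transpose_mat Gy * Gy) (U, V)"
      using U V D(4,5) by (simp add: cca_feasible_def feas feas')
  next
    assume "\<exists>W. cca_feasible (min a b) (transpose_mat Gx * Gx) (transpose_mat Gy * Gy) W
      \<and> cca_objective X Y (U, V) < cca_objective X Y W"
    then obtain U' V' where
      F: "cca_feasible (min a b) (transpose_mat Gx * Gx) (transpose_mat Gy * Gy) (U', V')"
      and gt: "mtrace S < cca_objective X Y (U', V')"
      using val by auto
    have d: "U' \<in> carrier_mat mx (min a b)" "V' \<in> carrier_mat my (min a b)"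
      using F by (auto simp: cca_feasible_def)
    then have dr: "dim_row U' = mx" "dim_row V' = my" by auto
    have "mtrace (transpose_mat (Gx * U') * T * (Gy * V')) \<le> mtrace S"
      using F d dr Gx Gy
      by (intro mtrace_le_mtrace_singular_values[OF svd T]) (auto simp: cca_feasible_def feas feas')
    with gt show False by (simp add: obj' dr)
  qed
qed

text \<open>The correlations are the diagonal entries of the product in \<open>eq\<close>, and a
  diagonal \<open>S\<close> is determined by them.\<close>

lemma canonical_correlations_eq:
  assumes "X \<in> carrier_mat n mx" "Y \<in> carrier_mat n my"
    and "U \<in> carrier_mat mx k" "V \<in> carrier_mat my k"
    and S: "S \<in> carrier_mat k k" "diagonal_mat S"
    and eq: "transpose_mat U * (transpose_mat X * Y) * V = S"
  shows "canonical_correlations X Y (U, V) = S"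
proof -
  have [simp]: "dim_row X = n" "dim_col X = mx" "dim_row Y = n" "dim_col Y = my"
    "dim_row U = mx" "dim_col U = k" "dim_row V = my" "dim_col V = k"
    using assms(1-4) by auto
  have "col U i \<bullet> ((transpose_mat X * Y) *\<^sub>v col V i) = S $$ (i, i)" if "i < k" for i
  proof -
    have "S $$ (i, i) = (transpose_mat U * (transpose_mat X * Y * V)) $$ (i, i)"
      by (subst eq[symmetric]) (simp add: mult_mat_assoc)
    also have "\<dots> = col U i \<bullet> col (transpose_mat X * Y * V) i"
      using that by (subst index_mult_mat) auto
    also have "col (transpose_mat X * Y * V) i = (transpose_mat X * Y) *\<^sub>v col V i"
      using that by (intro eq_vecI) (auto simp: col_def)
    finally show ?thesis by simp
  qed
  then have "mat_diag k (\<lambda>i. col U i \<bullet> ((transpose_mat X * Y) *\<^sub>v col V i))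
      = mat_diag k (\<lambda>i. S $$ (i, i))"
    by (auto simp: mat_diag_def)
  then show ?thesis
    by (simp add: canonical_correlations_def flip: diagonal_mat_eq_mat_diag[OF S])
qed

section \<open>Inverse square roots and inverses of diagonal matrices\<close>

lemma mtrace_uminus: "square_mat A \<Longrightarrow> mtrace (- A) = - mtrace A"
  by (simp add: mtrace_def sum_negf)

text \<open>If \<open>B\<^sup>2 = D\<^sup>2\<close>, then \<open>C = B - D\<close> anticommutes with \<open>E = B + D\<close>, so the trace of \<open>C E C\<close>
  vanishes; but it is the sum of the values of the positive definite form \<open>E\<close> at the columns
  of \<open>C\<close>.\<close>

lemma pos_def_mat_square_eq_imp_eq:
  assumes B: "B \<in> carrier_mat n n" "pos_def_mat B"
    and D: "D \<in> carrier_mat n n" "pos_def_mat D"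
    and sq: "B * B = D * D"
  shows "B = D"
proof -
  define C where "C = B - D"
  define E where "E = B + D"
  have C: "C \<in> carrier_mat n n" and E: "E \<in> carrier_mat n n"
    using B(1) D(1) by (auto simp: C_def E_def)
  have [simp]: "dim_row B = n" "dim_col B = n" "dim_row D = n" "dim_col D = n"
    "dim_row C = n" "dim_col C = n" "dim_row E = n" "dim_col E = n"
    using B(1) D(1) C E by auto
  have sym: "transpose_mat C = C"
    using B D by (simp add: C_def pos_def_mat_def transpose_minus[OF B(1)])
  have "C * E = B * E - D * E"
    unfolding C_def by (rule minus_mult_distrib_mat[OF B(1) D(1) E])
  also have "\<dots> = (B * B + B * D) - (D * B + D * D)"
    using B(1) D(1) by (simp add: E_def mult_add_distrib_mat[of _ n n _ n])
  finally have CE: "C * E = (D * D + B * D) - (D * B + D * D)"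
    by (simp add: sq)
  have "E * C = B * C + D * C"
    unfolding E_def by (rule add_mult_distrib_mat[OF B(1) D(1) C])
  also have "\<dots> = (B * B - B * D) + (D * B - D * D)"
    using B(1) D(1) by (simp add: C_def mult_minus_distrib_mat[of _ n n _ n])
  finally have EC: "E * C = (D * D - B * D) + (D * B - D * D)"
    by (simp add: sq)
  \<comment> \<open>The squares cancel: \<open>C * E\<close> is \<open>B * D - D * B\<close>, and
    \<open>E * C\<close> is \<open>D * B - B * D\<close>.\<close>
  have anti: "C * E = - (E * C)"
    unfolding CE EC by (rule eq_matI) auto
  \<comment> \<open>Anticommutation and cyclicity make this trace equal to its own negative.\<close>
  have "mtrace (C * (E * C)) = mtrace (- (E * C) * C)"
    by (simp flip: anti add: mult_mat_assoc)
  also have "- (E * C) * C = - (E * C * C)"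
    using C E by (intro uminus_mult_left_mat) simp
  also have "mtrace \<dots> = - mtrace (C * (E * C))"
    using mtrace_mult_commute[of "E * C" n n C] mult_carrier_mat[OF E C] C
    by (simp add: mtrace_uminus del: assoc_mult_mat)
  finally have tr0: "mtrace (C * (E * C)) = 0" by simp
  define h where "h i = col C i \<bullet> (E *\<^sub>v col C i)" for i
  have h: "(C * (E * C)) $$ (i, i) = h i" if "i < n" for i
  proof -
    have "(C * (E * C)) $$ (i, i) = (transpose_mat C * (E * C)) $$ (i, i)"
      by (simp add: sym)
    also have "\<dots> = col C i \<bullet> col (E * C) i"
      using that by (subst index_mult_mat) auto
    also have "col (E * C) i = E *\<^sub>v col C i"
      using that by (intro eq_vecI) auto
    finally show ?thesis by (simp add: h_def)
  qed
  have pos: "0 < h i" if "col C i \<noteq> 0\<^sub>v n" for i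
  proof -
    have c: "col C i \<in> carrier_vec n" by (simp add: carrier_vecI)
    have "h i = col C i \<bullet> (B *\<^sub>v col C i) + col C i \<bullet> (D *\<^sub>v col C i)"
      using B(1) D(1) c
      by (simp add: h_def E_def add_mult_distrib_mat_vec[of _ n n] scalar_prod_add_distrib[of _ n])
    moreover have "0 < col C i \<bullet> (B *\<^sub>v col C i)" "0 < col C i \<bullet> (D *\<^sub>v col C i)"
      using B D c that by (auto simp: pos_def_mat_def)
    ultimately show ?thesis by simp
  qed
  have nonneg: "0 \<le> h i" for i
  proof (cases "col C i = 0\<^sub>v n")
    case True
    have "E *\<^sub>v 0\<^sub>v n \<in> carrier_vec n" using E by simp
    with True show ?thesis by (simp add: h_def)
  qed (use pos in fastforce)
  have "(\<Sum>i<n. h i) = 0"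
    using tr0 h by (simp add: mtrace_def)
  then have "h i = 0" if "i < n" for i
    using nonneg that by (subst (asm) sum_nonneg_eq_0_iff) auto
  then have col0: "col C i = 0\<^sub>v n" if "i < n" for i
    using pos that by fastforce
  show ?thesis
  proof (rule eq_matI)
    fix i j assume "i < dim_row D" "j < dim_col D"
    then have "i < n" "j < n" by simp_all
    then have "C $$ (i, j) = col C j $ i" by simp
    also have "\<dots> = 0" using col0 \<open>i < n\<close> \<open>j < n\<close> by simp
    finally show "B $$ (i, j) = D $$ (i, j)"
      using \<open>i < n\<close> \<open>j < n\<close> by (simp add: C_def)
  qed auto
qed

lemma mat_diag_cong: "(\<And>i. i < n \<Longrightarrow> f i = g i) \<Longrightarrow> mat_diag n f = mat_diag n g"
  by (auto simp: mat_diag_def)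

lemma mat_diag_index:
  "i < n \<Longrightarrow> j < n \<Longrightarrow> mat_diag n f $$ (i, j) = (if i = j then f j else 0)"
  by (simp add: mat_diag_def)

lemma pos_def_mat_diag:
  assumes "\<And>i. i < n \<Longrightarrow> 0 < f i"
  shows "pos_def_mat (mat_diag n f)"
proof -
  have "0 < v \<bullet> (mat_diag n f *\<^sub>v v)" if v: "v \<in> carrier_vec n" "v \<noteq> 0\<^sub>v n" for v
  proof -
    have "(mat_diag n f *\<^sub>v v) $ i = f i * v $ i" if "i < n" for i
      using that v
      by (simp add: scalar_prod_def mat_diag_def atLeast0LessThan if_distrib[of "\<lambda>x. x * _"] cong: if_cong)
    then have eq: "v \<bullet> (mat_diag n f *\<^sub>v v) = (\<Sum>i<n. f i * (v $ i)\<^sup>2)"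
      by (auto simp: scalar_prod_def atLeast0LessThan power2_eq_square intro!: sum.cong)
    obtain i where i: "i < n" "v $ i \<noteq> 0"
      using v by (metis eq_vecI carrier_vecD index_zero_vec)
    have "0 < f i * (v $ i)\<^sup>2" using assms i by simp
    also have "\<dots> \<le> (\<Sum>i<n. f i * (v $ i)\<^sup>2)"
      using i assms by (intro member_le_sum) (auto intro!: mult_nonneg_nonneg intro: less_imp_le)
    finally show ?thesis by (simp add: eq)
  qed
  then show ?thesis by (simp add: pos_def_mat_def)
qed

text \<open>A definite description has to be evaluated, so uniqueness matters: the square of any
  candidate \<open>B\<close> is the inverse of the diagonal matrix, hence equals
  \<open>?D * ?D\<close>, and positive definite square roots are unique.\<close>

lemma inv_sqrt_mat_diag:
  assumes pos: "\<And>i. i < n \<Longrightarrow> 0 < f i"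
  shows "inv_sqrt_mat (mat_diag n f) = mat_diag n (\<lambda>i. 1 / sqrt (f i))"
  unfolding inv_sqrt_mat_def
proof (rule the_equality)
  let ?A = "mat_diag n f" and ?D = "mat_diag n (\<lambda>i. 1 / sqrt (f i))"
  have pD: "pos_def_mat ?D"
    using pos by (intro pos_def_mat_diag) simp
  have AD: "?A * (?D * ?D) = 1\<^sub>m n" and DA: "?D * ?D * ?A = 1\<^sub>m n"
    using pos[THEN less_imp_neq] pos[THEN less_imp_le]
    by (auto simp flip: mat_diag_one intro!: mat_diag_cong)
  then show "?D \<in> carrier_mat (dim_row ?A) (dim_row ?A) \<and> pos_def_mat ?D \<and> inverts_mat ?A (?D * ?D)"
    using pD by (simp add: inverts_mat_def)
  fix B assume "B \<in> carrier_mat (dim_row ?A) (dim_row ?A) \<and> pos_def_mat B \<and> inverts_mat ?A (B * B)"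
  then have B: "B \<in> carrier_mat n n" "pos_def_mat B" "?A * (B * B) = 1\<^sub>m n"
    by (auto simp: inverts_mat_def)
  have "B * B = ?D * ?D * ?A * (B * B)"
    using B(1) by (simp only: DA) simp
  also have "\<dots> = ?D * ?D * (?A * (B * B))"
    using B(1) by (intro mult_mat_assoc) auto
  also have "\<dots> = ?D * ?D"
    by (simp add: B(3))
  finally show "B = ?D"
    by (intro pos_def_mat_square_eq_imp_eq[OF B(1,2) mat_diag_dim pD])
qed

text \<open>The matrix is a unit of the matrix ring, so \<open>mat_inverse\<close> returns some
  right inverse; this coincides with the left inverse \<open>?D\<close>.\<close>

lemma inv_mat_diag:
  assumes "\<And>i. i < n \<Longrightarrow> f i \<noteq> 0"
  shows "inv_mat (mat_diag n f) = mat_diag n (\<lambda>i. 1 / f i)"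
proof -
  let ?A = "mat_diag n f" and ?D = "mat_diag n (\<lambda>i. 1 / f i)"
  have inv: "?A * ?D = 1\<^sub>m n" "?D * ?A = 1\<^sub>m n"
    using assms by (auto simp flip: mat_diag_one intro!: mat_diag_cong)
  then have "?A \<in> Units (ring_mat TYPE(real) n ())"
    by (auto simp: Units_def ring_mat_def intro!: bexI[of _ ?D])
  then obtain B where B: "mat_inverse ?A = Some B"
    using mat_inverse(1)[of ?A n "()"] by fastforce
  then have B': "?A * B = 1\<^sub>m n" "B \<in> carrier_mat n n"
    using mat_inverse(2)[of ?A n B] by auto
  have "B = ?D * ?A * B" using B'(2) by (simp only: inv(2)) simp
  also have "\<dots> = ?D * (?A * B)" using B'(2) by (intro mult_mat_assoc) auto
  also have "\<dots> = ?D" by (simp add: B'(1))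
  finally show ?thesis by (simp add: inv_mat_def B)
qed

section \<open>Tikhonov regularization\<close>

lemma tikhonov_whitener_diag:
  assumes "g > 0"
  shows "tikhonov_whitener g (mat_diag m s) = mat_diag m (\<lambda>i. 1 / sqrt ((s i)\<^sup>2 + g))"
proof -
  have "mat_diag m s * mat_diag m s + g \<cdot>\<^sub>m 1\<^sub>m m = mat_diag m (\<lambda>i. (s i)\<^sup>2 + g)"
    by (subst mat_diag_diag, intro eq_matI) (auto simp: mat_diag_def power2_eq_square)
  then show ?thesis
    using assms by (simp add: tikhonov_whitener_def inv_sqrt_mat_diag add_nonneg_pos)
qed

text \<open>For a tall matrix \<open>V\<close> is square, so orthonormality of its columns also
  gives \<open>V * transpose_mat V = 1\<^sub>m m\<close>.\<close>

lemma thin_svd_tall: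
  assumes "thin_svd X U S V" and "X \<in> carrier_mat n m" and "m \<le> n"
  shows "U \<in> carrier_mat n m" and "S \<in> carrier_mat m m" and "V \<in> carrier_mat m m"
    and "transpose_mat U * U = 1\<^sub>m m" and "transpose_mat V * V = 1\<^sub>m m" and "V * transpose_mat V = 1\<^sub>m m"
    and "S = mat_diag m (\<lambda>i. S $$ (i, i))"
    and "\<And>i j. i \<le> j \<Longrightarrow> j < m \<Longrightarrow> S $$ (j, j) \<le> S $$ (i, i)"
    and "X = U * S * transpose_mat V"
proof -
  have m: "min n m = m" using assms(3) by simp
  note D = thin_svdD[OF assms(1,2), unfolded m]
  show "U \<in> carrier_mat n m" "S \<in> carrier_mat m m" "V \<in> carrier_mat m m"
    "transpose_mat U * U = 1\<^sub>m m" "transpose_mat V * V = 1\<^sub>m m" "X = U * S * transpose_mat V"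
    "\<And>i j. i \<le> j \<Longrightarrow> j < m \<Longrightarrow> S $$ (j, j) \<le> S $$ (i, i)"
    by (fact D)+
  show "V * transpose_mat V = 1\<^sub>m m"
    using D(3,5) by (intro mat_mult_left_right_inverse[of "transpose_mat V" m]) auto
  show "S = mat_diag m (\<lambda>i. S $$ (i, i))"
    by (rule diagonal_mat_eq_mat_diag[OF D(2,6)])
qed

text \<open>The matrix obtained is \<open>mat_diag m d * transpose_mat V\<close>, with
  \<open>d\<close> the square roots of the regularized squared singular values. Its properties are
  those that the whitened problem asks for: it factors the constraint matrix, \<open>X\<close>
  factors through it, and it maps the claimed weights to \<open>P\<close>.\<close>

lemma tikhonov_whitening:
  assumes svd: "thin_svd X U S V" and X: "X \<in> carrier_mat n m" "m \<le> n" and g: "g > 0"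
  obtains G where "G \<in> carrier_mat m m"
    and "transpose_mat G * G = transpose_mat X * X + g \<cdot>\<^sub>m 1\<^sub>m m"
    and "X = U * (S * (tikhonov_whitener g S * G))"
    and "\<And>P. dim_row P = m \<Longrightarrow> G * (V * tikhonov_whitener g S * P) = P"
proof -
  note D = thin_svd_tall[OF svd X]
  define s where "s i = S $$ (i, i)" for i
  have S: "S = mat_diag m s"
    unfolding s_def by (rule D(7))
  define d where "d i = sqrt ((s i)\<^sup>2 + g)" for i
  have d: "d i > 0" for i
    using g by (simp add: d_def add_nonneg_pos)
  have dd: "d i * d i = s i * s i + g" for i
    using g by (simp add: d_def power2_eq_square)
  have W: "tikhonov_whitener g S = mat_diag m (\<lambda>i. 1 / d i)"
    using g by (simp add: S tikhonov_whitener_diag d_def)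
  define G where "G = mat_diag m d * transpose_mat V"
  have [simp]: "dim_row U = n" "dim_col U = m" "dim_row V = m" "dim_col V = m"
    "dim_row G = m" "dim_col G = m"
    using D(1,3) by (auto simp: G_def)
  have Wd: "mat_diag m (\<lambda>i. 1 / d i) * mat_diag m d = 1\<^sub>m m"
    "mat_diag m d * mat_diag m (\<lambda>i. 1 / d i) = 1\<^sub>m m"
    using d[THEN less_imp_neq] by (auto simp flip: mat_diag_one intro!: mat_diag_cong)
  have Xt: "X = U * (mat_diag m s * transpose_mat V)"
    by (simp add: D(9) S mult_mat_assoc)
  have XX: "transpose_mat X * X = V * (mat_diag m (\<lambda>i. s i * s i) * transpose_mat V)"
    by (simp add: Xt mat_mult_normalize mult_mat_assoc_eq[OF D(4)] mult_mat_assoc_eq[OF mat_diag_diag])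
  have "transpose_mat G * G = V * (mat_diag m (\<lambda>i. d i * d i) * transpose_mat V)"
    by (simp add: G_def mat_mult_normalize mult_mat_assoc_eq[OF mat_diag_diag])
  also have "mat_diag m (\<lambda>i. d i * d i) = mat_diag m (\<lambda>i. s i * s i) + g \<cdot>\<^sub>m 1\<^sub>m m"
    by (intro eq_matI) (auto simp: dd mat_diag_def)
  also have "V * (\<dots> * transpose_mat V)
      = V * (mat_diag m (\<lambda>i. s i * s i) * transpose_mat V + g \<cdot>\<^sub>m transpose_mat V)"
    using D(3) by (simp add: add_mult_distrib_mat[of _ m m _ _ m] mult_smult_assoc_mat[of _ m m _ m])
  \<comment> \<open>Orthogonality of the square \<open>V\<close> turns the second summand into a
    multiple of the identity.\<close>
  also have "\<dots> = transpose_mat X * X + g \<cdot>\<^sub>m 1\<^sub>m m"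
    unfolding XX
    by (subst mult_add_distrib_mat[of _ m m _ m])
      (use D(3) in \<open>auto simp: mult_smult_distrib[of _ m m _ m] D(6)\<close>)
  finally have GG: "transpose_mat G * G = transpose_mat X * X + g \<cdot>\<^sub>m 1\<^sub>m m" .
  \<comment> \<open>The whitener and \<open>mat_diag m d\<close> are inverse to each other and are
    inserted between \<open>S\<close> and \<open>transpose_mat V\<close>.\<close>
  have XG: "X = U * (S * (tikhonov_whitener g S * G))"
    by (simp only: W G_def) (simp add: Xt S mult_mat_assoc_eq[OF Wd(1)])
  have GV: "G * (V * tikhonov_whitener g S * P) = P" if "dim_row P = m" for P
    using that
    by (simp add: W G_def mult_mat_assoc mult_mat_assoc_eq[OF D(5)] mult_mat_assoc_eq[OF Wd(2)])
  show thesis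
    by (rule that[OF _ GG XG GV]) (auto intro: carrier_matI)
qed

text \<open>The filter is the whitener times the singular values; being diagonal, the two may be
  multiplied in either order, as the two sides of \<open>T\<close> require.\<close>

lemma tikhonov_T_eq_filter:
  assumes "thin_svd X Ux Sx Vx" "X \<in> carrier_mat n mx" "mx \<le> n" "gx > 0"
    and "thin_svd Y Uy Sy Vy" "Y \<in> carrier_mat n my" "my \<le> n" "gy > 0"
  shows "tikhonov_T gx gy Ux Sx Uy Sy \<in> carrier_mat mx my"
    and "tikhonov_T gx gy Ux Sx Uy Sy =
      tikhonov_filter gx Sx * (transpose_mat Ux * Uy) * tikhonov_filter gy Sy"
proof -
  note Dx = thin_svd_tall[OF assms(1-3)] and Dy = thin_svd_tall[OF assms(5-7)]
  have [simp]: "dim_row Ux = n" "dim_col Ux = mx" "dim_row Uy = n" "dim_col Uy = my"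
    using Dx(1) Dy(1) by auto
  obtain sx sy where S: "Sx = mat_diag mx sx" "Sy = mat_diag my sy"
    using Dx(7) Dy(7) by blast
  have fx: "tikhonov_filter gx Sx = tikhonov_whitener gx Sx * Sx"
    using assms(4)
    by (auto simp: S tikhonov_whitener_diag tikhonov_filter_def mat_diag_index intro!: mat_diag_cong)
  have fy: "tikhonov_filter gy Sy = Sy * tikhonov_whitener gy Sy"
    using assms(8)
    by (auto simp: S tikhonov_whitener_diag tikhonov_filter_def mat_diag_index intro!: mat_diag_cong)
  show "tikhonov_T gx gy Ux Sx Uy Sy =
      tikhonov_filter gx Sx * (transpose_mat Ux * Uy) * tikhonov_filter gy Sy"
    unfolding fx fy tikhonov_T_def
    using assms(4,8) by (simp add: S tikhonov_whitener_diag mult_mat_assoc)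
  then show "tikhonov_T gx gy Ux Sx Uy Sy \<in> carrier_mat mx my"
    by (auto simp: tikhonov_filter_def S intro: carrier_matI)
qed

lemma tikhonov_cca:
  assumes svdX: "thin_svd X Ux Sx Vx" and X: "X \<in> carrier_mat n mx" "mx \<le> n" and gx: "gx > 0"
    and svdY: "thin_svd Y Uy Sy Vy" and Y: "Y \<in> carrier_mat n my" "my \<le> n" and gy: "gy > 0"
    and svdT: "thin_svd (tikhonov_T gx gy Ux Sx Uy Sy) Px S Py"
  defines "U \<equiv> Vx * tikhonov_whitener gx Sx * Px" and "V \<equiv> Vy * tikhonov_whitener gy Sy * Py"
  shows "tikhonov_cca_solution gx gy X Y (U, V)"
    and "canonical_correlations X Y (U, V) = S"
proof -
  let ?T = "tikhonov_T gx gy Ux Sx Uy Sy"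
  obtain Gx where Gx: "Gx \<in> carrier_mat mx mx"
    "transpose_mat Gx * Gx = transpose_mat X * X + gx \<cdot>\<^sub>m 1\<^sub>m mx"
    "X = Ux * (Sx * (tikhonov_whitener gx Sx * Gx))"
    "\<And>P. dim_row P = mx \<Longrightarrow> Gx * (Vx * tikhonov_whitener gx Sx * P) = P"
    using tikhonov_whitening[OF svdX X gx] by blast
  obtain Gy where Gy: "Gy \<in> carrier_mat my my"
    "transpose_mat Gy * Gy = transpose_mat Y * Y + gy \<cdot>\<^sub>m 1\<^sub>m my"
    "Y = Uy * (Sy * (tikhonov_whitener gy Sy * Gy))"
    "\<And>P. dim_row P = my \<Longrightarrow> Gy * (Vy * tikhonov_whitener gy Sy * P) = P"
    using tikhonov_whitening[OF svdY Y gy] by blast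
  note Dx = thin_svd_tall[OF svdX X] and Dy = thin_svd_tall[OF svdY Y]
  note T = tikhonov_T_eq_filter(1)[OF svdX X gx svdY Y gy]
  note DT = thin_svdD[OF svdT T]
  have [simp]: "dim_row Ux = n" "dim_col Ux = mx" "dim_row Uy = n" "dim_col Uy = my"
    "dim_row Gx = mx" "dim_col Gx = mx" "dim_row Gy = my" "dim_col Gy = my"
    "dim_row Vx = mx" "dim_col Vx = mx" "dim_row Vy = my" "dim_col Vy = my"
    "dim_row Px = mx" "dim_col Px = min mx my" "dim_row Py = my" "dim_col Py = min mx my"
    using Dx(1,3) Dy(1,3) Gx(1) Gy(1) DT(1,3) by auto
  obtain sx sy where S: "Sx = mat_diag mx sx" "Sy = mat_diag my sy"
    using Dx(7) Dy(7) by blast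
  \<comment> \<open>Transposing the factorization of \<open>X\<close> puts the whitener before
    \<open>Sx\<close>, so the inner factors appear in exactly the order of
    \<open>tikhonov_T\<close>.\<close>
  have cross: "transpose_mat X * Y = transpose_mat Gx * ?T * Gy"
    unfolding Gx(3) Gy(3) tikhonov_T_def
    using gx gy by (simp add: S tikhonov_whitener_diag mat_mult_normalize mult_mat_assoc_eq[OF mat_diag_diag])
  have U: "U \<in> carrier_mat mx (min mx my)" "Gx * U = Px"
    using Gx(4) by (auto simp: U_def intro: carrier_matI)
  have V: "V \<in> carrier_mat my (min mx my)" "Gy * V = Py"
    using Gy(4) by (auto simp: V_def intro: carrier_matI)
  note sol = whitened_cca_solution[OF X(1) Y(1) Gx(1) Gy(1) T svdT cross U V]
  show "tikhonov_cca_solution gx gy X Y (U, V)"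
    using sol(1) X(1) Y(1) by (simp add: tikhonov_cca_solution_def Gx(2) Gy(2))
  show "canonical_correlations X Y (U, V) = S"
    by (rule canonical_correlations_eq[OF X(1) Y(1) U(1) V(1) DT(2) DT(6) sol(2)])
qed

section \<open>Leading blocks and the spectral filter of the truncation\<close>

lemma leading_block_dim [simp]:
  "dim_row (leading_block r c A) = r" "dim_col (leading_block r c A) = c"
  by (simp_all add: leading_block_def)

lemma leading_block_carrier [simp]: "leading_block r c A \<in> carrier_mat r c"
  by (simp add: leading_block_def)

lemma leading_block_index [simp]:
  "i < r \<Longrightarrow> j < c \<Longrightarrow> leading_block r c A $$ (i, j) = A $$ (i, j)"
  by (simp add: leading_block_def)

lemma leading_block_gram:
  assumes "U \<in> carrier_mat n m" "U' \<in> carrier_mat n m'" "k \<le> m" "k' \<le> m'"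
  shows "transpose_mat (leading_block n k U) * leading_block n k' U'
    = leading_block k k' (transpose_mat U * U')"
  using assms by (intro eq_matI) (auto simp: scalar_prod_def)

lemma mult_leading_block:
  assumes "A \<in> carrier_mat n m" "B \<in> carrier_mat m l" "k \<le> l"
  shows "A * leading_block m k B = leading_block n k (A * B)"
  using assms by (intro eq_matI) (auto simp: scalar_prod_def)

lemma leading_block_mult_diag:
  assumes "A \<in> carrier_mat n m" "k \<le> m"
  shows "leading_block n k (A * mat_diag m s) = leading_block n k A * mat_diag k s"
  using assms
  by (intro eq_matI)
    (auto simp: mat_diag_mult_right[of A n m] mat_diag_mult_right[of "leading_block n k A" n k]
      simp del: index_mult_mat)

lemma leading_block_one: "k \<le> m \<Longrightarrow> leading_block k k (1\<^sub>m m) = 1\<^sub>m k"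
  by (intro eq_matI) auto

lemma leading_block_diag: "k \<le> m \<Longrightarrow> leading_block k k (mat_diag m s) = mat_diag k s"
  by (intro eq_matI) (auto simp: mat_diag_index)

text \<open>By the decreasing order the filter is 1 at every retained index. Ties may give further
  entries 1 beyond the cut, but these lie outside the block.\<close>

lemma tsvd_T_eq_leading_block:
  assumes svdX: "thin_svd X Ux Sx Vx" "X \<in> carrier_mat n mx" "mx \<le> n" "1 \<le> kx" "kx \<le> mx"
    and svdY: "thin_svd Y Uy Sy Vy" "Y \<in> carrier_mat n my" "my \<le> n" "1 \<le> ky" "ky \<le> my"
  shows "tsvd_T kx ky Ux Uy =
    leading_block kx ky (tsvd_filter kx Sx * (transpose_mat Ux * Uy) * tsvd_filter ky Sy)"
proof -
  note Dx = thin_svd_tall[OF svdX(1-3)] and Dy = thin_svd_tall[OF svdY(1-3)]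
  have [simp]: "dim_row Ux = n" "dim_col Ux = mx" "dim_row Uy = n" "dim_col Uy = my"
    "dim_row Sx = mx" "dim_row Sy = my"
    using Dx(1,2) Dy(1,2) by auto
  have fx: "\<not> Sx $$ (i, i) < Sx $$ (kx - 1, kx - 1)" if "i < kx" for i
  proof -
    have "i \<le> kx - 1" "kx - 1 < mx" using that svdX(4,5) by auto
    then show ?thesis using Dx(8)[of i "kx - 1"] by simp
  qed
  have fy: "\<not> Sy $$ (i, i) < Sy $$ (ky - 1, ky - 1)" if "i < ky" for i
  proof -
    have "i \<le> ky - 1" "ky - 1 < my" using that svdY(4,5) by auto
    then show ?thesis using Dy(8)[of i "ky - 1"] by simp
  qed
  have M: "transpose_mat Ux * Uy \<in> carrier_mat mx my"
    by (rule carrier_matI; simp)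
  have "tsvd_T kx ky Ux Uy = leading_block kx ky (transpose_mat Ux * Uy)"
    using leading_block_gram[OF Dx(1) Dy(1) svdX(5) svdY(5)] by (simp add: tsvd_T_def)
  also have "\<dots> = leading_block kx ky (tsvd_filter kx Sx * (transpose_mat Ux * Uy) * tsvd_filter ky Sy)"
    using svdX svdY fx fy
    by (intro eq_matI)
      (simp_all add: tsvd_filter_def mat_diag_mult_left[OF M] mat_diag_mult_right[of _ mx]
        del: index_mult_mat)
  finally show ?thesis .
qed

section \<open>Truncation of a single data matrix\<close>

text \<open>Keeps only identities between the retained blocks; \<open>R\<close> is the inverse of
  the retained singular values \<open>S\<close>. The link from \<open>A\<close> to its truncation
  \<open>Ak\<close> is \<open>AV\<close>: both matrices map \<open>V\<close> to
  \<open>U * S\<close>.\<close>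

locale svd_truncation =
  fixes n m k :: nat and A Ak U S R V :: "real mat"
  assumes A: "A \<in> carrier_mat n m" and U: "U \<in> carrier_mat n k" and V: "V \<in> carrier_mat m k"
    and S: "S \<in> carrier_mat k k" and R: "R \<in> carrier_mat k k"
    and UU: "transpose_mat U * U = 1\<^sub>m k" and VV: "transpose_mat V * V = 1\<^sub>m k"
    and St: "transpose_mat S = S" and SR: "S * R = 1\<^sub>m k" and RS: "R * S = 1\<^sub>m k"
    and AV: "A * V = U * S" and Ak: "Ak = U * S * transpose_mat V"
begin

lemma dims [simp]: "dim_row A = n" "dim_col A = m" "dim_row U = n" "dim_col U = k"
  "dim_row V = m" "dim_col V = k" "dim_row S = k" "dim_col S = k" "dim_row R = k" "dim_col R = k"
  using A U V S R by auto

lemma Ak_eq: "Ak = U * (S * transpose_mat V)"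
  by (simp add: Ak mult_mat_assoc)

lemma Ak_dims [simp]: "dim_row Ak = n" "dim_col Ak = m"
  by (simp_all add: Ak_eq)

text \<open>The whitening factor: omitting the orthonormal \<open>U\<close> from \<open>Ak\<close>
  leaves the Gram matrix unchanged.\<close>

definition G where "G = S * transpose_mat V"

lemma G: "G \<in> carrier_mat k m"
  by (rule carrier_matI; simp add: G_def)

lemma gram_eq: "transpose_mat Ak * Ak = transpose_mat G * G"
  by (simp add: Ak_eq G_def mat_mult_normalize mult_mat_assoc_eq[OF UU])

lemma G_weights: "dim_row P = k \<Longrightarrow> G * (V * R * P) = P"
  by (simp add: G_def mult_mat_assoc mult_mat_assoc_eq[OF VV] mult_mat_assoc_eq[OF SR])

lemma weights_in_row_space: "dim_row P = k \<Longrightarrow> cols_in_row_space Ak (V * R * P)"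
  unfolding cols_in_row_space_def
  \<comment> \<open>In \<open>transpose_mat Ak\<close> times this witness, \<open>U\<close> cancels
    against its transpose and one \<open>R\<close> against \<open>S\<close>, which leaves
    \<open>V * R * P\<close>.\<close>
  by (rule bexI[of _ "U * (R * (R * P))"])
    (auto simp: Ak_eq mat_mult_normalize St mult_mat_assoc_eq[OF UU] mult_mat_assoc_eq[OF SR] intro: carrier_matI)

text \<open>Columns in the row space are combinations of the columns of \<open>V\<close>, where
  \<open>A\<close> and \<open>Ak\<close> agree.\<close>

lemma row_space_mult_eq:
  assumes "cols_in_row_space Ak W"
  shows "A * W = Ak * W"
proof -
  obtain C where "C \<in> carrier_mat n (dim_col W)" "W = transpose_mat Ak * C"
    using assms by (auto simp: cols_in_row_space_def)
  then have "dim_row C = n" "W = transpose_mat Ak * C" by auto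
  then show ?thesis
    by (simp add: Ak_eq mat_mult_normalize St mult_mat_assoc_eq[OF AV] mult_mat_assoc_eq[OF VV])
qed

text \<open>The orthogonal projection onto the row space of \<open>Ak\<close>, which the columns of
  \<open>V\<close> span.\<close>

definition proj where "proj W = V * (transpose_mat V * W)"

lemma proj_dims [simp]: "dim_row (proj W) = m" "dim_col (proj W) = dim_col W"
  by (simp_all add: proj_def)

lemma mult_proj: "dim_row W = m \<Longrightarrow> Ak * proj W = Ak * W"
  by (simp add: Ak_eq proj_def mult_mat_assoc mult_mat_assoc_eq[OF VV])

lemma proj_in_row_space: "dim_row W = m \<Longrightarrow> cols_in_row_space Ak (proj W)"
  unfolding cols_in_row_space_def
  \<comment> \<open>The witness works because \<open>transpose_mat Ak * (U * R)\<close> is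
    \<open>V\<close>.\<close>
  by (rule bexI[of _ "U * (R * (transpose_mat V * W))"])
    (auto simp: Ak_eq proj_def mat_mult_normalize St mult_mat_assoc_eq[OF UU] mult_mat_assoc_eq[OF SR] intro: carrier_matI)

end

lemma svd_truncationI:
  assumes svd: "thin_svd X U S V" and X: "X \<in> carrier_mat n m" "m \<le> n"
    and k: "1 \<le> k" "k \<le> m" and pos: "0 < S $$ (k - 1, k - 1)"
  shows "svd_truncation n m k X (truncated_svd k U S V) (leading_block n k U)
    (leading_block k k S) (inv_mat (leading_block k k S)) (leading_block m k V)"
proof -
  note D = thin_svd_tall[OF svd X]
  define s where "s i = S $$ (i, i)" for i
  have S: "S = mat_diag m s"
    unfolding s_def by (rule D(7))
  have Sk: "leading_block k k S = mat_diag k s"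
    using k by (simp add: S leading_block_diag)
  \<comment> \<open>The smallest retained singular value, at index \<open>k - 1\<close>, is
    positive, so the retained block is invertible.\<close>
  have nz: "s i \<noteq> 0" if "i < k" for i
    using D(8)[of i "k - 1"] pos k that by (fastforce simp: s_def)
  then have R: "inv_mat (leading_block k k S) = mat_diag k (\<lambda>i. 1 / s i)"
    by (simp add: Sk inv_mat_diag)
  have [simp]: "dim_row U = n" "dim_row V = m" "dim_col U = m" "dim_col V = m" using D(1,3) by auto
  have XV: "X * V = U * S"
    by (simp add: D(9) S mult_mat_assoc D(5))
  show ?thesis
  proof
    \<comment> \<open>These are the first \<open>k\<close> columns of \<open>X * V = U * S\<close>;
      as \<open>S\<close> is diagonal, cutting the product cuts both factors.\<close>
    show "X * leading_block m k V = leading_block n k U * leading_block k k S"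
      using k D(1,3) X by (simp add: mult_leading_block[of X n m V m] XV Sk)
        (simp add: S leading_block_mult_diag)
    show "leading_block k k S * inv_mat (leading_block k k S) = 1\<^sub>m k"
      "inv_mat (leading_block k k S) * leading_block k k S = 1\<^sub>m k"
      unfolding R unfolding Sk using nz by (auto simp flip: mat_diag_one intro!: mat_diag_cong)
    show "transpose_mat (leading_block n k U) * leading_block n k U = 1\<^sub>m k"
      using k D(1,4) by (simp add: leading_block_gram[of U n m U m] leading_block_one)
    show "transpose_mat (leading_block m k V) * leading_block m k V = 1\<^sub>m k"
      using k D(3,5) by (simp add: leading_block_gram[of V m m V m] leading_block_one)
    show "truncated_svd k U S V
      = leading_block n k U * leading_block k k S * transpose_mat (leading_block m k V)"
      by (simp add: truncated_svd_def)
    show "transpose_mat (leading_block k k S) = leading_block k k S" by (simp add: Sk)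
    show "inv_mat (leading_block k k S) \<in> carrier_mat k k" by (simp add: R)
  qed (use X in \<open>auto intro: carrier_matI\<close>)
qed

section \<open>Linearity of the objective in each weight matrix\<close>

lemma cca_objective_eq:
  assumes "X \<in> carrier_mat n mx" "Y \<in> carrier_mat n my" "dim_row U = mx" "dim_row V = my"
  shows "cca_objective X Y (U, V) = mtrace (transpose_mat (X * U) * (Y * V))"
  using assms by (auto simp: cca_objective_def mat_mult_normalize carrier_matD)

text \<open>The argument of \<open>M\<close> is the point reflection of \<open>C'\<close> at
  \<open>C\<close>, written without scalar multiples.\<close>

lemma mult_mat_reflect:
  fixes M :: "real mat"
  assumes "M \<in> carrier_mat n m" "C \<in> carrier_mat m k" "C' \<in> carrier_mat m k"
  shows "M * (C + (C - C')) = M * C + (M * C - M * C')"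
proof -
  have "C - C' \<in> carrier_mat m k" using assms(3) by (rule minus_carrier_mat)
  then show ?thesis
    by (simp add: mult_add_distrib_mat[OF assms(1,2)] mult_minus_distrib_mat[OF assms])
qed

text \<open>For use at an optimum: if reflecting \<open>U'\<close> at \<open>U\<close> does not
  improve on \<open>U\<close>, then \<open>U'\<close> is at least as good as
  \<open>U\<close>.\<close>

lemma cca_objective_reflect:
  assumes "X \<in> carrier_mat n mx" "Y \<in> carrier_mat n my" "U \<in> carrier_mat mx k" "U' \<in> carrier_mat mx k"
    "V \<in> carrier_mat my k" "V' \<in> carrier_mat my k"
  shows "cca_objective X Y (U + (U - U'), V) = 2 * cca_objective X Y (U, V) - cca_objective X Y (U', V)"
    and "cca_objective X Y (U, V + (V - V')) = 2 * cca_objective X Y (U, V) - cca_objective X Y (U, V')"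
proof -
  have tr: "cca_objective X Y (A, B) = (\<Sum>i<k. \<Sum>l<n. (X * A) $$ (l, i) * (Y * B) $$ (l, i))"
    if "A \<in> carrier_mat mx k" "B \<in> carrier_mat my k" for A B
    using assms(1,2) that
    by (subst cca_objective_eq[OF assms(1,2)])
      (auto simp: mtrace_def scalar_prod_def atLeast0LessThan intro!: sum.cong)
  have refl: "(M * (A + (A - A'))) $$ (l, i) = 2 * (M * A) $$ (l, i) - (M * A') $$ (l, i)"
    if "M \<in> carrier_mat n m" "A \<in> carrier_mat m k" "A' \<in> carrier_mat m k" "l < n" "i < k" for M A A' :: "real mat" and m l i
    unfolding mult_mat_reflect[OF that(1-3)] using that by simp
  have c: "U + (U - U') \<in> carrier_mat mx k" "V + (V - V') \<in> carrier_mat my k"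
    using assms by auto
  show "cca_objective X Y (U + (U - U'), V) = 2 * cca_objective X Y (U, V) - cca_objective X Y (U', V)"
    using assms c
    by (simp add: tr refl[of X mx U U'] sum_distrib_left sum_subtractf algebra_simps del: index_mult_mat)
  show "cca_objective X Y (U, V + (V - V')) = 2 * cca_objective X Y (U, V) - cca_objective X Y (U, V')"
    using assms c
    by (simp add: tr refl[of Y my V V'] sum_distrib_left sum_subtractf algebra_simps del: index_mult_mat)
qed

section \<open>Truncated SVD regularization for two data matrices\<close>

locale svd_truncation_pair =
  x: svd_truncation n mx kx X Xk Ux Sx Rx Vx + y: svd_truncation n my ky Y Yk Uy Sy Ry Vy
  for n mx kx X Xk Ux Sx Rx Vx my ky Y Yk Uy Sy Ry Vy +
  fixes Px S Py :: "real mat"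
  assumes svdT: "thin_svd (transpose_mat Ux * Uy) Px S Py"
begin

abbreviation "k \<equiv> min kx ky"

definition U where "U = Vx * Rx * Px"

definition V where "V = Vy * Ry * Py"

lemma T_carrier: "transpose_mat Ux * Uy \<in> carrier_mat kx ky"
  by (rule carrier_matI; simp)

lemmas svdT_facts = thin_svdD[OF svdT T_carrier]

lemma P_dims [simp]: "dim_row Px = kx" "dim_col Px = k" "dim_row Py = ky" "dim_col Py = k"
  using svdT_facts(1,3) by auto

lemma U: "U \<in> carrier_mat mx k" and V: "V \<in> carrier_mat my k"
  by (rule carrier_matI; simp add: U_def V_def)+

lemma UV_dims [simp]: "dim_row U = mx" "dim_col U = k" "dim_row V = my" "dim_col V = k"
  using U V by auto

lemma truncated_carrier: "Xk \<in> carrier_mat n mx" "Yk \<in> carrier_mat n my"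
  by (rule carrier_matI; simp)+

text \<open>Makes visible that the constraints depend on the weights only through
  \<open>Xk * A\<close> and \<open>Yk * B\<close>, so changes within the kernels preserve
  feasibility.\<close>

lemma feasible_iff:
  "tsvd_cca_feasible kx ky Xk Yk (A, B) \<longleftrightarrow>
    A \<in> carrier_mat mx k \<and> B \<in> carrier_mat my k \<and>
    transpose_mat (Xk * A) * (Xk * A) = 1\<^sub>m k \<and> transpose_mat (Yk * B) * (Yk * B) = 1\<^sub>m k"
proof -
  have "transpose_mat A * (transpose_mat Xk * Xk) * A = transpose_mat (Xk * A) * (Xk * A)"
    if "A \<in> carrier_mat mx k"
    using carrier_matD[OF that] by (simp add: mat_mult_normalize)
  moreover have "transpose_mat B * (transpose_mat Yk * Yk) * B = transpose_mat (Yk * B) * (Yk * B)"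
    if "B \<in> carrier_mat my k"
    using carrier_matD[OF that] by (simp add: mat_mult_normalize)
  ultimately show ?thesis
    by (auto simp: tsvd_cca_feasible_def cca_feasible_def)
qed

text \<open>With truncated data in the objective too, the cross product factors through
  \<open>x.G\<close> and \<open>y.G\<close>, and the whitened problem gives the optimum over all
  feasible weights.\<close>

lemma truncated_solution:
  "tsvd_cca_solution kx ky Xk Yk Xk Yk (U, V)"
  "transpose_mat U * (transpose_mat Xk * Yk) * V = S"
proof -
  have cross: "transpose_mat Xk * Yk = transpose_mat x.G * (transpose_mat Ux * Uy) * y.G"
    by (simp add: x.Ak_eq y.Ak_eq x.G_def y.G_def mat_mult_normalize)
  have GU: "x.G * U = Px" and GV: "y.G * V = Py"
    by (simp_all add: U_def V_def x.G_weights y.G_weights)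
  note sol = whitened_cca_solution[OF truncated_carrier x.G y.G T_carrier svdT cross U GU V GV]
  show "tsvd_cca_solution kx ky Xk Yk Xk Yk (U, V)"
    using sol(1) unfolding tsvd_cca_solution_def tsvd_cca_feasible_def[abs_def] x.gram_eq y.gram_eq .
  show "transpose_mat U * (transpose_mat Xk * Yk) * V = S" by (fact sol(2))
qed

lemma feasible: "tsvd_cca_feasible kx ky Xk Yk (U, V)"
  using truncated_solution(1) by (simp add: tsvd_cca_solution_def is_arg_max_def)

lemma UV_in_row_space: "cols_in_row_space Xk U" "cols_in_row_space Yk V"
  by (simp_all add: U_def V_def x.weights_in_row_space y.weights_in_row_space)

lemma row_space_objective_eq:
  assumes "cols_in_row_space Xk A" "cols_in_row_space Yk B"
  shows "cca_objective X Y (A, B) = cca_objective Xk Yk (A, B)"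
proof -
  have "dim_row A = mx" "dim_row B = my"
    using assms by (auto simp: cols_in_row_space_def)
  then show ?thesis
    by (simp add: cca_objective_eq[OF x.A y.A] cca_objective_eq[OF truncated_carrier]
        x.row_space_mult_eq[OF assms(1)] y.row_space_mult_eq[OF assms(2)])
qed

text \<open>On the row spaces the objectives of the full and of the truncated data coincide, so
  optimality for the truncated data carries over.\<close>

lemma row_space_optimum:
  assumes "tsvd_cca_feasible kx ky Xk Yk (A, B)" "cols_in_row_space Xk A" "cols_in_row_space Yk B"
  shows "cca_objective X Y (A, B) \<le> cca_objective X Y (U, V)"
  using truncated_solution(1) assms
  by (auto simp: row_space_objective_eq UV_in_row_space tsvd_cca_solution_def is_arg_max_def not_less)

lemma row_space_solution: "tsvd_cca_row_space_solution kx ky Xk Yk X Y (U, V)"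
  unfolding tsvd_cca_row_space_solution_def is_arg_max_def
  using feasible UV_in_row_space row_space_optimum by (auto simp: not_less)

lemma correlations: "canonical_correlations X Y (U, V) = S"
proof (rule canonical_correlations_eq[OF x.A y.A U V svdT_facts(2,6)])
  have "transpose_mat U * (transpose_mat X * Y) * V = transpose_mat (X * U) * (Y * V)"
    by (simp add: mat_mult_normalize)
  also have "\<dots> = transpose_mat (Xk * U) * (Yk * V)"
    by (simp add: x.row_space_mult_eq y.row_space_mult_eq UV_in_row_space)
  also have "\<dots> = S"
    using truncated_solution(2) by (simp add: mat_mult_normalize)
  finally show "transpose_mat U * (transpose_mat X * Y) * V = S" .
qed

text \<open>The reflection \<open>A + (A - P A)\<close> of an optimal \<open>A\<close> at the row space is again feasible, and the
  objective is linear in \<open>A\<close>; so projecting \<open>A\<close> does not decrease the objective.\<close>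

lemma solution_if_exists:
  assumes "tsvd_cca_solution kx ky Xk Yk X Y W"
  shows "tsvd_cca_solution kx ky Xk Yk X Y (U, V)"
proof -
  let ?F = "tsvd_cca_feasible kx ky Xk Yk" and ?f = "cca_objective X Y"
  obtain A B where W: "W = (A, B)" by fastforce
  have F: "?F (A, B)" and max: "\<And>A' B'. ?F (A', B') \<Longrightarrow> ?f (A', B') \<le> ?f (A, B)"
    using assms by (auto simp: W tsvd_cca_solution_def is_arg_max_def not_less)
  have A: "A \<in> carrier_mat mx k" and B: "B \<in> carrier_mat my k"
    using F by (auto simp: feasible_iff)
  have [simp]: "dim_row A = mx" "dim_col A = k" "dim_row B = my" "dim_col B = k"
    using A B by auto
  have pA: "x.proj A \<in> carrier_mat mx k" and pB: "y.proj B \<in> carrier_mat my k"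
    by (rule carrier_matI; simp)+
  \<comment> \<open>The projection has the same image under \<open>M\<close> as the original, hence
    so has the reflected matrix, and feasibility is kept.\<close>
  have refl: "M * (C + (C - C')) = M * C"
    if "M \<in> carrier_mat n m" "C \<in> carrier_mat m k" "C' \<in> carrier_mat m k" "M * C' = M * C" for M C C' :: "real mat" and m
    unfolding mult_mat_reflect[OF that(1-3)] that(4) using that(1,2) by (intro eq_matI) auto
  have rA: "A + (A - x.proj A) \<in> carrier_mat mx k"
    "Xk * (A + (A - x.proj A)) = Xk * A"
    by (rule carrier_matI; simp)
      (rule refl[OF truncated_carrier(1) A pA], simp add: x.mult_proj)
  have rB: "B + (B - y.proj B) \<in> carrier_mat my k"
    "Yk * (B + (B - y.proj B)) = Yk * B"
    by (rule carrier_matI; simp)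
      (rule refl[OF truncated_carrier(2) B pB], simp add: y.mult_proj)
  have "?f (A + (A - x.proj A), B) \<le> ?f (A, B)"
    using F rA by (intro max) (simp add: feasible_iff)
  then have 1: "?f (A, B) \<le> ?f (x.proj A, B)"
    by (simp add: cca_objective_reflect(1)[OF x.A y.A A pA B B])
  \<comment> \<open>The two sides are projected in turn. Fact \<open>1\<close> replaces the bound by
    \<open>?f (x.proj A, B)\<close>, which is what the second reflection has to be compared
    with.\<close>
  have "?f (x.proj A, B + (B - y.proj B)) \<le> ?f (A, B)"
    using F rB pA by (intro max) (simp add: feasible_iff x.mult_proj)
  with 1 have "?f (x.proj A, B) \<le> ?f (x.proj A, y.proj B)"
    by (simp add: cca_objective_reflect(2)[OF x.A y.A pA pA B pB])
  also have "\<dots> \<le> ?f (U, V)"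
    using F pA pB
    by (intro row_space_optimum)
      (simp_all add: feasible_iff x.mult_proj y.mult_proj x.proj_in_row_space y.proj_in_row_space)
  finally have "?f (A, B) \<le> ?f (U, V)" using 1 by simp
  then have "?f (A', B') \<le> ?f (U, V)" if "?F (A', B')" for A' B'
    using max[OF that] by simp
  then show ?thesis
    using feasible by (auto simp: tsvd_cca_solution_def is_arg_max_def not_less)
qed

end

text \<open>The truncation claim takes several forms because the objective of the full data may be
  unbounded on the feasible set: optimality there is conditional on a solution existing, and
  unconditional on the row spaces and for the truncated data.\<close>

theorem theorem1:
  fixes n mx my :: nat
    and X Y Ux Sx Vx Uy Sy Vy :: "real mat"
  assumes n: "n > max mx my"
    and X: "X \<in> carrier_mat n mx" "centered X"
    and Y: "Y \<in> carrier_mat n my" "centered Y"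
    and svd_X: "thin_svd X Ux Sx Vx"
    and svd_Y: "thin_svd Y Uy Sy Vy"
  shows
    "(\<forall>gx gy :: real. \<forall>Px S Py :: real mat.
        gx > 0 \<and> gy > 0 \<and> thin_svd (tikhonov_T gx gy Ux Sx Uy Sy) Px S Py \<longrightarrow>
        (let U = Vx * tikhonov_whitener gx Sx * Px;
             V = Vy * tikhonov_whitener gy Sy * Py
         in tikhonov_cca_solution gx gy X Y (U, V) \<and>
            canonical_correlations X Y (U, V) = S))
     \<and>
     (\<forall>kx ky :: nat. \<forall>Px S Py :: real mat.
        1 \<le> kx \<and> kx \<le> mx \<and> 1 \<le> ky \<and> ky \<le> my \<and>
        Sx $$ (kx - 1, kx - 1) > 0 \<and> Sy $$ (ky - 1, ky - 1) > 0 \<and>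
        thin_svd (tsvd_T kx ky Ux Uy) Px S Py \<longrightarrow>
        (let Xk = truncated_svd kx Ux Sx Vx;
             Yk = truncated_svd ky Uy Sy Vy;
             U = leading_block mx kx Vx * inv_mat (leading_block kx kx Sx) * Px;
             V = leading_block my ky Vy * inv_mat (leading_block ky ky Sy) * Py
         in tsvd_cca_feasible kx ky Xk Yk (U, V) \<and>
            ((\<exists>W. tsvd_cca_solution kx ky Xk Yk X Y W) \<longrightarrow>
               tsvd_cca_solution kx ky Xk Yk X Y (U, V)) \<and>
            tsvd_cca_row_space_solution kx ky Xk Yk X Y (U, V) \<and>
            tsvd_cca_solution kx ky Xk Yk Xk Yk (U, V) \<and>
            canonical_correlations X Y (U, V) = S))
     \<and>
     (\<forall>gx gy :: real. gx > 0 \<and> gy > 0 \<longrightarrow>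
        tikhonov_T gx gy Ux Sx Uy Sy =
          tikhonov_filter gx Sx * (transpose_mat Ux * Uy) * tikhonov_filter gy Sy)
     \<and>
     (\<forall>kx ky :: nat. 1 \<le> kx \<and> kx \<le> mx \<and> 1 \<le> ky \<and> ky \<le> my \<longrightarrow>
        tsvd_T kx ky Ux Uy =
          leading_block kx ky
            (tsvd_filter kx Sx * (transpose_mat Ux * Uy) * tsvd_filter ky Sy))"
proof -
  have nx: "mx \<le> n" and ny: "my \<le> n" using n by auto
  note sx = svd_X X(1) nx and sy = svd_Y Y(1) ny
  have [simp]: "dim_row Ux = n" "dim_row Uy = n"
    using thin_svd_tall(1)[OF sx] thin_svd_tall(1)[OF sy] by auto
  have tsvd: "tsvd_cca_feasible kx ky Xk Yk (U, V) \<and>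
      ((\<exists>W. tsvd_cca_solution kx ky Xk Yk X Y W) \<longrightarrow> tsvd_cca_solution kx ky Xk Yk X Y (U, V)) \<and>
      tsvd_cca_row_space_solution kx ky Xk Yk X Y (U, V) \<and>
      tsvd_cca_solution kx ky Xk Yk Xk Yk (U, V) \<and>
      canonical_correlations X Y (U, V) = S"
    if "1 \<le> kx" "kx \<le> mx" "1 \<le> ky" "ky \<le> my"
      "0 < Sx $$ (kx - 1, kx - 1)" "0 < Sy $$ (ky - 1, ky - 1)"
      "thin_svd (tsvd_T kx ky Ux Uy) Px S Py"
      and defs: "Xk = truncated_svd kx Ux Sx Vx" "Yk = truncated_svd ky Uy Sy Vy"
      "U = leading_block mx kx Vx * inv_mat (leading_block kx kx Sx) * Px"
      "V = leading_block my ky Vy * inv_mat (leading_block ky ky Sy) * Py"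
    for kx ky Px S Py Xk Yk U V
  proof -
    \<comment> \<open>The leading blocks instantiate the locale, and \<open>tsvd_T\<close> is its
      product of left factors.\<close>
    interpret p: svd_truncation_pair n mx kx X Xk "leading_block n kx Ux"
      "leading_block kx kx Sx" "inv_mat (leading_block kx kx Sx)" "leading_block mx kx Vx"
      my ky Y Yk "leading_block n ky Uy"
      "leading_block ky ky Sy" "inv_mat (leading_block ky ky Sy)" "leading_block my ky Vy"
      Px S Py
      unfolding defs
      by (intro svd_truncation_pair.intro svd_truncation_pair_axioms.intro
          svd_truncationI[OF sx that(1,2,5)] svd_truncationI[OF sy that(3,4,6)])
        (use that(7) in \<open>simp add: tsvd_T_def\<close>)
    show ?thesis
      unfolding defs(3,4) p.U_def[symmetric] p.V_def[symmetric]
      using p.feasible p.solution_if_exists p.row_space_solution p.truncated_solution(1)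
        p.correlations by blast
  qed
  show ?thesis
  proof (intro conjI, goal_cases)
    case 1
    show ?case
      by (auto simp: Let_def intro!: tikhonov_cca[OF sx _ sy])
  next
    case 2
    show ?case
      unfolding Let_def
      by (intro allI impI, elim conjE, rule tsvd; (assumption | rule refl))
  next
    case 3
    show ?case
      by (intro allI impI, elim conjE, rule tikhonov_T_eq_filter(2)[OF sx _ sy])
  next
    case 4
    show ?case
      by (intro allI impI, elim conjE, rule tsvd_T_eq_leading_block[OF sx _ _ sy])
  qed
qed

end
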